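(* Let $r,\delta$ be integers with $0 \le \delta < r$. Let $N_{r,\delta}$ be the number of almost irreducible polynomials in $\mathbb{Z}_2[x]$ with exponent $r$ and increment $\delta$, and let $I_r$ be the number of irreducible polynomials of degree $r$ in $\mathbb{Z}_2[x]$, excluding the polynomial $x$. Then $$N_{r,\delta} = 2^{\max(0,\delta-1)} I_r.$$
   Context: $\mathbb{Z}_2 = \mathrm{GF}(2)$ is the field with two elements. A polynomial $P \in \mathbb{Z}_2[x]$ of degree $n$ is almost irreducible if $P(0)\neq 0$ and $P$ has an irreducible factor of degree $r$ for some $r > n/2$; one then says that $P$ has exponent $r$ and increment $n-r$. *)

theory Defs
  imports "HOL-Library.Z2" "HOL-Computational_Algebra.Computational_Algebra"
begin

text \<open>The field \<open>GF(2)\<close> is the type \<^typ>\<open>bit\<close>. The condition \<open>r > n/2\<close> is written as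
  \<open>2 * r > n\<close>, where \<open>n\<close> is the degree.\<close>

definition has_exponent :: "bit poly \<Rightarrow> nat \<Rightarrow> bool" where
  "has_exponent P r \<longleftrightarrow> (\<exists>q. irreducible q \<and> q dvd P \<and> degree q = r \<and> 2 * r > degree P)"

definition almost_irreducible :: "bit poly \<Rightarrow> bool" where
  "almost_irreducible P \<longleftrightarrow> poly P 0 \<noteq> 0 \<and> (\<exists>r. has_exponent P r)"

text \<open>The increment \<open>n - r\<close>, stated additively to avoid truncated subtraction.\<close>

definition has_increment :: "bit poly \<Rightarrow> nat \<Rightarrow> bool" where
  "has_increment P d \<longleftrightarrow> (\<exists>r. has_exponent P r \<and> degree P = r + d)"

definition num_almost_irreducible :: "nat \<Rightarrow> nat \<Rightarrow> nat" where
  "num_almost_irreducible r d =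
     card {P. almost_irreducible P \<and> has_exponent P r \<and> has_increment P d}"

definition num_irreducible :: "nat \<Rightarrow> nat" where
  "num_irreducible r = card {p :: bit poly. irreducible p \<and> degree p = r \<and> p \<noteq> [:0, 1:]}"

end

theory Submission
  imports Defs
begin

text \<open>The irreducible factor of degree above half is unique, so an almost irreducible polynomial
  with exponent \<open>r\<close> and increment \<open>\<delta>\<close> factors uniquely as \<open>q * s\<close> with \<open>q \<noteq> x\<close> irreducible of degree
  \<open>r\<close> and \<open>s\<close> of degree \<open>\<delta>\<close> with \<open>s(0) \<noteq> 0\<close>. The two outer coefficients of \<open>s\<close> are \<open>1\<close> (and
  coincide if \<open>\<delta> = 0\<close>), while the remaining ones are free.\<close>

lemma bit_poly_degree_0:
  fixes p :: "bit poly"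
  assumes "p \<noteq> 0" "degree p = 0"
  shows "p = 1"
proof -
  obtain c where "p = [:c:]"
    using assms(2) by (rule degree_eq_zeroE)
  with assms(1) show ?thesis
    by (cases c) (auto simp: one_pCons)
qed

text \<open>Over GF(2) the only unit is 1, so associated irreducibles are literally equal and no
  choice of monic representatives is needed.\<close>

lemma bit_poly_irreducible_dvd_irreducible:
  fixes p q :: "bit poly"
  assumes "irreducible p" "irreducible q" "p dvd q"
  shows "p = q"
proof -
  obtain c where c: "q = p * c"
    using assms(3) by (rule dvdE)
  with assms(1,2) have "c dvd 1"
    by (metis irreducible_def)
  then have "c = 1"
    by (intro bit_poly_degree_0) (auto simp: is_unit_poly_iff)
  with c show ?thesis by simp
qed

text \<open>Turns the exclusion of x from the irreducibles into the condition on the constant term,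
  which is multiplicative.\<close>

lemma bit_poly_irreducible_poly_0:
  fixes q :: "bit poly"
  assumes "irreducible q"
  shows "poly q 0 = 0 \<longleftrightarrow> q = [:0, 1:]"
proof
  assume "poly q 0 = 0"
  then have "[:0, 1:] dvd q"
    by (simp add: poly_eq_0_iff_dvd)
  moreover have "irreducible [:0, 1 :: bit:]"
    by (rule irreducible_linear_field_poly) simp
  ultimately show "q = [:0, 1:]"
    using assms by (metis bit_poly_irreducible_dvd_irreducible)
qed simp

text \<open>Since \<open>q\<close> is prime and too large in degree to divide \<open>t\<close>, it
  must divide \<open>p\<close>. This serves both the uniqueness of the exponent and the injectivity
  of the product map.\<close>

lemma bit_poly_irreducible_factor_unique:
  fixes q s p t :: "bit poly"
  assumes "irreducible q" "irreducible p" "q * s = p * t" "t \<noteq> 0" "degree t < degree q"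
  shows "q = p"
proof -
  have "prime_elem q"
    using assms(1) by (rule field_poly_irreducible_imp_prime)
  moreover have "q dvd p * t"
    by (simp flip: assms(3))
  moreover have "\<not> q dvd t"
    using assms(4,5) by (meson dvd_imp_degree_le not_le)
  ultimately have "q dvd p"
    by (metis prime_elem_dvd_mult_iff)
  with assms(1,2) show ?thesis
    by (rule bit_poly_irreducible_dvd_irreducible)
qed

lemma has_exponent_unique:
  assumes "P \<noteq> 0" "has_exponent P r" "has_exponent P r'"
  shows "r = r'"
proof -
  obtain q p where q: "irreducible q" "q dvd P" "degree q = r" "2 * r > degree P"
    and p: "irreducible p" "p dvd P" "degree p = r'" "2 * r' > degree P"
    using assms(2,3) unfolding has_exponent_def by blast
  obtain s t where s: "P = q * s" and t: "P = p * t"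
    using q(2) p(2) by (meson dvdE)
  have "p \<noteq> 0" "t \<noteq> 0"
    using assms(1) t by auto
  then have "degree P = r' + degree t"
    using p(3) t by (simp add: degree_mult_eq)
  \<comment> \<open>Both exponents exceed half of n = \<open>degree P\<close>, so
    \<open>degree t\<close> = n - r' < n/2 < r.\<close>
  then have "degree t < degree q"
    using q p by linarith
  with q p s t \<open>t \<noteq> 0\<close> show ?thesis
    by (metis bit_poly_irreducible_factor_unique)
qed

lemma card_bit_poly_degree: "card {p :: bit poly. p \<noteq> 0 \<and> degree p = n} = 2 ^ n"
proof (induction n)
  case 0
  have "{p :: bit poly. p \<noteq> 0 \<and> degree p = 0} = {1}"
    using bit_poly_degree_0 by auto
  then show ?case by simp
next
  case (Suc n)
  let ?D = "\<lambda>n. {p :: bit poly. p \<noteq> 0 \<and> degree p = n}"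
  have "?D (Suc n) = (\<lambda>(a, p). pCons a p) ` (UNIV \<times> ?D n)"
  proof (intro set_eqI iffI)
    fix p assume p: "p \<in> ?D (Suc n)"
    obtain a u where "p = pCons a u" by (rule pCons_cases)
    with p show "p \<in> (\<lambda>(a, p). pCons a p) ` (UNIV \<times> ?D n)"
      by (auto split: if_splits)
  qed auto
  moreover have "inj_on (\<lambda>(a, p). pCons a p) (UNIV \<times> ?D n)"
    by (auto simp: inj_on_def)
  ultimately have "card (?D (Suc n)) = card (UNIV :: bit set) * card (?D n)"
    by (simp add: card_image card_cartesian_product)
  also have "(UNIV :: bit set) = {0, 1}"
    using bit.exhaust by auto
  finally show ?case using Suc by simp
qed

text \<open>Stripping the constant coefficient, which must be 1, reduces to the previous count. For
  n = 0 the truncated \<open>n - 1\<close> is 0, matching the single polynomial 1.\<close>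

lemma card_bit_poly_degree_nonzero_const:
  "card {p :: bit poly. degree p = n \<and> poly p 0 \<noteq> 0} = 2 ^ (n - 1)"
proof (cases n)
  case 0
  have "{p :: bit poly. degree p = 0 \<and> poly p 0 \<noteq> 0} = {1}"
  proof (intro set_eqI iffI)
    fix p :: "bit poly" assume "p \<in> {p. degree p = 0 \<and> poly p 0 \<noteq> 0}"
    then show "p \<in> {1}"
      by (metis (mono_tags, lifting) mem_Collect_eq singletonI bit_poly_degree_0 poly_0)
  qed simp
  with 0 show ?thesis by simp
next
  case (Suc m)
  let ?D = "{p :: bit poly. p \<noteq> 0 \<and> degree p = m}"
  have "{p :: bit poly. degree p = n \<and> poly p 0 \<noteq> 0} = pCons 1 ` ?D"
  proof (intro set_eqI iffI)
    fix p :: "bit poly" assume p: "p \<in> {p. degree p = n \<and> poly p 0 \<noteq> 0}"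
    obtain a u where "p = pCons a u" by (rule pCons_cases)
    with p Suc show "p \<in> pCons 1 ` ?D"
      by (cases a) (auto split: if_splits)
  qed (auto simp: Suc)
  moreover have "inj_on (pCons 1) ?D"
    by (auto simp: inj_on_def)
  ultimately show ?thesis
    using Suc by (simp add: card_image card_bit_poly_degree)
qed

lemma almost_irreducible_set_eq:
  assumes "\<delta> < r"
  shows "{P. almost_irreducible P \<and> has_exponent P r \<and> has_increment P \<delta>} =
    (\<lambda>(q, s). q * s) `
      ({q. irreducible q \<and> degree q = r \<and> q \<noteq> [:0, 1:]} \<times> {s. degree s = \<delta> \<and> poly s 0 \<noteq> 0})"
    (is "?L = ?f ` (?A \<times> ?B)")
proof (intro set_eqI iffI)
  fix P assume "P \<in> ?L"
  then have P: "poly P 0 \<noteq> 0" "has_exponent P r" "has_increment P \<delta>"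
    by (auto simp: almost_irreducible_def)
  then have "P \<noteq> 0" by auto
  \<comment> \<open>\<open>has_increment\<close> binds an exponent of its own; uniqueness identifies
    it with \<open>r\<close>.\<close>
  then have deg: "degree P = r + \<delta>"
    using P(2,3) has_exponent_unique unfolding has_increment_def by blast
  obtain q s where q: "irreducible q" "degree q = r" "P = q * s"
    using P(2) unfolding has_exponent_def dvd_def by blast
  then have "poly q 0 \<noteq> 0" "poly s 0 \<noteq> 0"
    using P(1) by auto
  moreover have "degree s = \<delta>"
    using deg q \<open>P \<noteq> 0\<close> by (auto simp: degree_mult_eq)
  ultimately have "(q, s) \<in> ?A \<times> ?B"
    using q by auto
  then show "P \<in> ?f ` (?A \<times> ?B)"
    using q(3) by auto
next
  fix P assume "P \<in> ?f ` (?A \<times> ?B)"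
  then obtain q s where q: "irreducible q" "degree q = r" "q \<noteq> [:0, 1:]"
    and s: "degree s = \<delta>" "poly s 0 \<noteq> 0" and P: "P = q * s"
    by auto
  have "q \<noteq> 0" "s \<noteq> 0" "poly q 0 \<noteq> 0"
    using q s bit_poly_irreducible_poly_0 by auto
  then have deg: "degree P = r + \<delta>" and "poly P 0 \<noteq> 0"
    using P q s by (auto simp: degree_mult_eq)
  \<comment> \<open>Here \<delta> < r is what gives 2r > r + \<delta> =
    \<open>degree P\<close>.\<close>
  moreover have "has_exponent P r"
    unfolding has_exponent_def using deg q P assms by (intro exI[of _ q]) auto
  ultimately show "P \<in> ?L"
    by (auto simp: almost_irreducible_def has_increment_def)
qed

theorem theorem9p1:
  fixes r \<delta> :: nat
  assumes "\<delta> < r"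
  shows "num_almost_irreducible r \<delta> = 2 ^ nat (max 0 (int \<delta> - 1)) * num_irreducible r"
proof -
  let ?A = "{q :: bit poly. irreducible q \<and> degree q = r \<and> q \<noteq> [:0, 1:]}"
  let ?B = "{s :: bit poly. degree s = \<delta> \<and> poly s 0 \<noteq> 0}"
  have "inj_on (\<lambda>(q, s). q * s) (?A \<times> ?B)"
  proof (rule inj_onI, clarify)
    fix q s p t :: "bit poly"
    assume *: "irreducible q" "irreducible p" "r = degree q" "degree p = degree q"
      "\<delta> = degree s" "degree t = degree s" "poly t 0 \<noteq> 0" "q * s = p * t"
    have "t \<noteq> 0" using *(7) by auto
    \<comment> \<open>The cofactor \<open>t\<close> has degree \<delta> < r =
      \<open>degree q\<close>, so the large irreducible factors agree; cancelling them then gives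
      \<open>s = t\<close>.\<close>
    with * assms have "q = p"
      by (metis bit_poly_irreducible_factor_unique)
    moreover have "q \<noteq> 0"
      using *(1) by auto
    ultimately show "q = p \<and> s = t"
      using *(8) by simp
  qed
  then have "num_almost_irreducible r \<delta> = card ?A * card ?B"
    unfolding num_almost_irreducible_def almost_irreducible_set_eq[OF assms]
    by (simp add: card_image card_cartesian_product)
  \<comment> \<open>The integer maximum with 0 is exactly truncated subtraction on the naturals, the
    form in which the cofactors were counted.\<close>
  moreover have "nat (max 0 (int \<delta> - 1)) = \<delta> - 1"
    by simp
  ultimately show ?thesis
    by (simp only: card_bit_poly_degree_nonzero_const num_irreducible_def mult.commute)
qed

end
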